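(* Let $G$ be a finite group and let $H$ be a normal subgroup of $G$. Then the normal subgroup based power graph $\Gamma_H(G)$ is a Cayley graph if and only if $G/H$ is a cyclic group of order $1$ or $p^m$ for some prime number $p$ and some $m\in\mathbb{N}$.
   Context: For a finite group $G$ with identity $e$ and a normal subgroup $H$ of $G$, the normal subgroup based power graph $\Gamma_H(G)$ is the simple undirected graph with vertex set $V(\Gamma_H(G))=(G\setminus H)\cup\{e\}$, in which two distinct vertices $x,y$ are adjacent if and only if $xH=y^mH$ or $yH=x^nH$ for some $m,n\in\mathbb{N}$. Here $\mathbb{N}$ denotes the positive integers. For a group $K$ and a subset $C\subseteq K$ closed under taking inverses and not containing the identity, the Cayley graph $\Gamma(K,C)$ is the graph with vertex set $K$ in which $g,h\in K$ are adjacent if and only if $hg^{-1}\in C$. A graph is called a Cayley graph if it is isomorphic to $\Gamma(K,C)$ for some group $K$ and some such $C$. *)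

theory Defs
  imports
    "HOL-Algebra.Elementary_Groups"
    "HOL-Computational_Algebra.Primes"
    "Graph_Theory.Pair_Digraph"
    "Graph_Theory.Digraph_Isomorphism"
begin

text \<open>
  Simple undirected graphs are represented as in \<open>Graph_Theory\<close>: as loop-free digraphs without
  multiple arcs whose arc relation is symmetric, so \<open>x\<close> and \<open>y\<close> are adjacent iff \<open>(x, y)\<close> is an arc.
\<close>

definition nsb_power_graph :: "('a, 'b) monoid_scheme \<Rightarrow> 'a set \<Rightarrow> 'a pair_pre_digraph" where
  "nsb_power_graph G H =
     (let V = (carrier G - H) \<union> {\<one>\<^bsub>G\<^esub>} in
      \<lparr> pverts = V,
        parcs = {(x, y). x \<in> V \<and> y \<in> V \<and> x \<noteq> y \<and>
          ((\<exists>m::nat. m > 0 \<and> x <#\<^bsub>G\<^esub> H = (y [^]\<^bsub>G\<^esub> m) <#\<^bsub>G\<^esub> H) \<or>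
           (\<exists>n::nat. n > 0 \<and> y <#\<^bsub>G\<^esub> H = (x [^]\<^bsub>G\<^esub> n) <#\<^bsub>G\<^esub> H))} \<rparr>)"

definition connection_set :: "('a, 'b) monoid_scheme \<Rightarrow> 'a set \<Rightarrow> bool" where
  "connection_set K C \<longleftrightarrow> C \<subseteq> carrier K \<and> \<one>\<^bsub>K\<^esub> \<notin> C \<and> (\<forall>c\<in>C. inv\<^bsub>K\<^esub> c \<in> C)"

definition cayley_graph :: "('a, 'b) monoid_scheme \<Rightarrow> 'a set \<Rightarrow> 'a pair_pre_digraph" where
  "cayley_graph K C =
     \<lparr> pverts = carrier K,
       parcs = {(g, h). g \<in> carrier K \<and> h \<in> carrier K \<and> h \<otimes>\<^bsub>K\<^esub> inv\<^bsub>K\<^esub> g \<in> C} \<rparr>"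

text \<open>
  The quantifier over groups can only range over one element type; we take the vertex type of the
  graph. Nothing is lost: \<open>is_cayley_graphI\<close> below shows that a graph isomorphic to a Cayley graph
  of a group over any type satisfies this definition.
\<close>

definition is_cayley_graph :: "'a pair_pre_digraph \<Rightarrow> bool" where
  "is_cayley_graph D \<longleftrightarrow>
     (\<exists>(K :: 'a monoid) C. group K \<and> connection_set K C \<and>
        digraph_iso (with_proj D) (with_proj (cayley_graph K C)))"

lemma pair_graph_nsb_power_graph:
  assumes "finite (carrier G)" "H \<lhd> G"
  shows "pair_graph (nsb_power_graph G H)"
proof -
  let ?D = "nsb_power_graph G H"
  have fin: "finite (pverts ?D)" using assms(1) by (simp add: nsb_power_graph_def Let_def)
  have "parcs ?D \<subseteq> pverts ?D \<times> pverts ?D" by (auto simp: nsb_power_graph_def Let_def)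
  then have "finite (parcs ?D)" using fin by (meson finite_SigmaI finite_subset)
  then show ?thesis
    using fin
    by unfold_locales (auto simp: nsb_power_graph_def Let_def symmetric_def sym_def)
qed

lemma pair_bidirected_cayley_graph:
  assumes "group K" "connection_set K C"
  shows "pair_bidirected_digraph (cayley_graph K C)"
proof -
  interpret K: group K by fact
  have inv: "g \<otimes>\<^bsub>K\<^esub> inv\<^bsub>K\<^esub> h \<in> C"
    if "g \<in> carrier K" "h \<in> carrier K" "h \<otimes>\<^bsub>K\<^esub> inv\<^bsub>K\<^esub> g \<in> C" for g h
    using assms(2) that unfolding connection_set_def
    by (metis K.inv_closed K.inv_inv K.inv_mult_group)
  show ?thesis
    using assms(2) inv
    by unfold_locales (auto simp: cayley_graph_def connection_set_def symmetric_def sym_def)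
qed

text \<open>For graphs without parallel arcs, \<^const>\<open>digraph_iso\<close> is the usual notion of graph
  isomorphism.\<close>

lemma digraph_iso_with_proj_iff:
  assumes A: "pair_wf_digraph A" and B: "pair_wf_digraph B"
  shows "digraph_iso (with_proj A) (with_proj B) \<longleftrightarrow>
    (\<exists>f. bij_betw f (pverts A) (pverts B) \<and>
       (\<forall>x\<in>pverts A. \<forall>y\<in>pverts A. (x, y) \<in> parcs A \<longleftrightarrow> (f x, f y) \<in> parcs B))"
    (is "?L \<longleftrightarrow> ?R")
proof
  assume ?L
  then obtain h where h: "pre_digraph.digraph_isomorphism (with_proj A) h"
    and eq: "with_proj B = app_iso h (with_proj A)"
    unfolding digraph_iso_def by blast
  have eqs: "pverts B = iso_verts h ` pverts A" "parcs B = iso_arcs h ` parcs A"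
    "iso_tail h = fst" "iso_head h = snd"
    using eq by (auto simp: with_proj_def app_iso_def)
  let ?f = "iso_verts h"
  have inj: "inj_on ?f (pverts A)"
    and arc: "\<And>a. a \<in> parcs A \<Longrightarrow> iso_arcs h a = (?f (fst a), ?f (snd a))"
    using h eqs unfolding pre_digraph.digraph_isomorphism_def by (auto simp: prod_eq_iff)
  have "(x, y) \<in> parcs A \<longleftrightarrow> (?f x, ?f y) \<in> parcs B" if "x \<in> pverts A" "y \<in> pverts A" for x y
  proof
    assume "(x, y) \<in> parcs A"
    then show "(?f x, ?f y) \<in> parcs B" unfolding eqs using arc by force
  next
    assume "(?f x, ?f y) \<in> parcs B"
    then obtain a where a: "a \<in> parcs A" "?f x = ?f (fst a)" "?f y = ?f (snd a)"
      unfolding eqs using arc by auto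
    then have "x = fst a" "y = snd a"
      using inj_onD[OF inj] that a pair_wf_digraph.arc_fst_in_verts[OF A]
        pair_wf_digraph.arc_snd_in_verts[OF A]
      by blast+
    then show "(x, y) \<in> parcs A" using a by simp
  qed
  then show ?R using inj eqs by (intro exI[of _ ?f]) (auto simp: bij_betw_def)
next
  assume ?R
  then obtain f where f: "bij_betw f (pverts A) (pverts B)"
    and adj: "\<And>x y. x \<in> pverts A \<Longrightarrow> y \<in> pverts A \<Longrightarrow> (x, y) \<in> parcs A \<longleftrightarrow> (f x, f y) \<in> parcs B"
    by blast
  have sub: "x \<in> pverts A \<and> y \<in> pverts A" if "(x, y) \<in> parcs A" for x y
    using pair_wf_digraph.in_arcsD1[OF A that] pair_wf_digraph.in_arcsD2[OF A that] by simp
  have subB: "x \<in> pverts B \<and> y \<in> pverts B" if "(x, y) \<in> parcs B" for x y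
    using pair_wf_digraph.in_arcsD1[OF B that] pair_wf_digraph.in_arcsD2[OF B that] by simp
  define h where "h = \<lparr>iso_verts = f, iso_arcs = map_prod f f, iso_head = snd, iso_tail = fst\<rparr>"
  have inj: "inj_on f (pverts A)" and im: "pverts B = f ` pverts A"
    using f by (auto simp: bij_betw_def)
  have "inj_on (map_prod f f) (parcs A)"
    by (rule inj_on_subset[OF map_prod_inj_on[OF inj inj]]) (use sub in auto)
  then have iso: "pre_digraph.digraph_isomorphism (with_proj A) h"
    using inj A unfolding pre_digraph.digraph_isomorphism_def wf_digraph_wp_iff
    by (auto simp: h_def)
  have "parcs B = map_prod f f ` parcs A"
  proof (intro equalityI subsetI)
    fix b assume b: "b \<in> parcs B"
    obtain u v where uv: "b = (u, v)" by (cases b)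
    with b subB im obtain x y where "x \<in> pverts A" "y \<in> pverts A" "u = f x" "v = f y" by blast
    with b uv adj show "b \<in> map_prod f f ` parcs A" by (auto intro!: rev_image_eqI[of "(x, y)"])
  next
    fix b assume "b \<in> map_prod f f ` parcs A"
    then show "b \<in> parcs B" using adj sub by auto
  qed
  then have "with_proj B = app_iso h (with_proj A)"
    using im by (simp add: with_proj_def app_iso_def h_def)
  with iso show ?L unfolding digraph_iso_def by blast
qed

lemma is_cayley_graphI:
  fixes D :: "'a pair_pre_digraph" and K :: "('k, 'm) monoid_scheme"
  assumes D: "pair_wf_digraph D" and K: "group K" and C: "connection_set K C"
    and iso: "digraph_iso (with_proj D) (with_proj (cayley_graph K C))"
  shows "is_cayley_graph D"
proof -
  interpret K: group K by fact
  have wf: "pair_wf_digraph (cayley_graph K C)" by unfold_locales (auto simp: cayley_graph_def)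
  obtain f where f: "bij_betw f (pverts D) (carrier K)"
    and adj: "\<And>x y. x \<in> pverts D \<Longrightarrow> y \<in> pverts D \<Longrightarrow>
      (x, y) \<in> parcs D \<longleftrightarrow> (f x, f y) \<in> parcs (cayley_graph K C)"
    using iso unfolding digraph_iso_with_proj_iff[OF D wf] by (auto simp: cayley_graph_def)
  define g where "g = the_inv_into (pverts D) f"
  have inj: "inj_on f (pverts D)" and im: "f ` pverts D = carrier K"
    using f by (auto simp: bij_betw_def)
  have fcl: "f x \<in> carrier K" if "x \<in> pverts D" for x using im that by blast
  have gcl: "g k \<in> pverts D" if "k \<in> carrier K" for k
    using that inj im the_inv_into_into[of f "pverts D" k "pverts D"] by (simp add: g_def)
  have fg: "f (g k) = k" if "k \<in> carrier K" for k
    using that inj im by (simp add: g_def f_the_inv_into_f)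
  have gf: "g (f x) = x" if "x \<in> pverts D" for x
    using that inj by (simp add: g_def the_inv_into_f_f)
  define L :: "'a monoid"
    where "L = \<lparr>carrier = pverts D, monoid.mult = (\<lambda>x y. g (f x \<otimes>\<^bsub>K\<^esub> f y)), one = g \<one>\<^bsub>K\<^esub>\<rparr>"
  have L: "group L"
  proof (rule groupI)
    fix x assume "x \<in> carrier L"
    then show "\<exists>y\<in>carrier L. y \<otimes>\<^bsub>L\<^esub> x = \<one>\<^bsub>L\<^esub>"
      by (intro bexI[of _ "g (inv\<^bsub>K\<^esub> f x)"]) (auto simp: L_def fg gcl fcl)
  qed (auto simp: L_def fg gf gcl fcl K.m_assoc)
  interpret L: group L by fact
  have invL: "inv\<^bsub>L\<^esub> x = g (inv\<^bsub>K\<^esub> f x)" if "x \<in> pverts D" for x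
    using that by (intro L.inv_equality) (auto simp: L_def fg gcl fcl)
  have mem: "g k \<in> g ` C \<longleftrightarrow> k \<in> C" if "k \<in> carrier K" for k
    using that C fg unfolding connection_set_def by (metis image_iff subsetD)
  have "connection_set L (g ` C)"
  proof -
    have "g \<one>\<^bsub>K\<^esub> \<notin> g ` C" using C mem by (simp add: connection_set_def)
    moreover have "g ` C \<subseteq> pverts D" using C gcl by (auto simp: connection_set_def)
    moreover have "inv\<^bsub>L\<^esub> (g c) \<in> g ` C" if "c \<in> C" for c
      using C that by (auto simp: connection_set_def invL gcl fg subset_iff)
    ultimately show ?thesis by (auto simp: connection_set_def L_def)
  qed
  moreover have "digraph_iso (with_proj D) (with_proj (cayley_graph L (g ` C)))"
  proof -
    have wfL: "pair_wf_digraph (cayley_graph L (g ` C))"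
      by unfold_locales (auto simp: cayley_graph_def)
    have carL: "carrier L = pverts D" by (simp add: L_def)
    have "y \<otimes>\<^bsub>L\<^esub> inv\<^bsub>L\<^esub> x \<in> g ` C \<longleftrightarrow> f y \<otimes>\<^bsub>K\<^esub> inv\<^bsub>K\<^esub> f x \<in> C"
      if "x \<in> pverts D" "y \<in> pverts D" for x y
      using that by (simp add: invL) (simp add: L_def fg fcl mem)
    then have "\<forall>x\<in>pverts D. \<forall>y\<in>pverts D.
        (x, y) \<in> parcs D \<longleftrightarrow> (id x, id y) \<in> parcs (cayley_graph L (g ` C))"
      using adj fcl by (auto simp: cayley_graph_def carL)
    moreover have "bij_betw id (pverts D) (pverts (cayley_graph L (g ` C)))"
      by (simp add: cayley_graph_def carL)
    ultimately show ?thesis unfolding digraph_iso_with_proj_iff[OF D wfL] by blast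
  qed
  ultimately show ?thesis unfolding is_cayley_graph_def using L by blast
qed

end

theory Submission
  imports Defs "HOL-Algebra.Multiplicative_Group" "HOL-Number_Theory.Cong"
begin

text \<open>
  The identity is adjacent to every other vertex, and a Cayley graph with such a vertex has all
  non-identity elements in its connection set, so it is complete. Hence the graph is Cayley iff it
  is complete, i.e. iff any two elements of \<open>G/H\<close> are comparable under ``is a power of''. In a
  finite group this forces an element of maximal order to be a generator, and elements of two
  distinct prime orders are never comparable.
\<close>

section \<open>Recognizing prime powers\<close>

lemma nat_primepowI:
  fixes n :: nat
  assumes "n > 1" and uniq: "\<And>p q. prime p \<Longrightarrow> prime q \<Longrightarrow> p dvd n \<Longrightarrow> q dvd n \<Longrightarrow> p = q"
  obtains p m where "prime p" "m > 0" "n = p ^ m"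
proof -
  obtain p where p: "prime p" "p dvd n"
    using assms(1) by (metis less_irrefl prime_factor_nat)
  have "\<not> is_unit p" "n \<noteq> 0" using p(1) assms(1) by auto
  then obtain r where r: "n = p ^ multiplicity p n * r" "\<not> p dvd r"
    using multiplicity_decompose'[of n p] by blast
  \<comment> \<open>A prime factor of the \<open>p\<close>-free part \<open>r\<close> would be a
    second prime divisor of \<open>n\<close>.\<close>
  have "r = 1"
  proof (rule ccontr)
    assume "r \<noteq> 1"
    then obtain q where q: "prime q" "q dvd r" using prime_factor_nat by blast
    then have "q dvd n" using r(1) by (metis dvd_mult)
    with uniq[OF p(1) q(1) p(2)] q r(2) show False by blast
  qed
  moreover have "multiplicity p n > 0"
    using p assms(1) by (simp add: prime_multiplicity_gt_zero_iff)
  ultimately show ?thesis using that[of p "multiplicity p n"] p r(1) by simp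
qed

section \<open>Powers and their comparability in finite groups\<close>

context group
begin

lemma pow_cong_ord:
  fixes i j :: nat
  assumes "x \<in> carrier G" "[i = j] (mod ord x)"
  shows "x [^] i = x [^] j"
proof -
  \<comment> \<open>Integer exponents avoid truncated subtraction when \<open>j < i\<close>.\<close>
  have "int (ord x) dvd int j - int i"
    using assms(2) by (metis cong_iff_dvd_diff cong_int_iff cong_sym)
  then show ?thesis using int_pow_eq[OF assms(1), of "int i" "int j"] by (simp add: int_pow_int)
qed

text \<open>Exponents commute: raising \<open>x [^] k\<close> to the power \<open>ord x\<close>
  gives a power of the identity.\<close>

lemma ord_pow_dvd:
  fixes k :: nat
  assumes "x \<in> carrier G"
  shows "ord (x [^] k) dvd ord x"
  using assms by (metis nat_pow_closed nat_pow_one nat_pow_pow mult.commute pow_eq_id pow_ord_eq_1)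

text \<open>The library describes cyclic groups by integer exponents. In a finite group every order
  is nonzero, so natural exponents already reach the whole generated subgroup.\<close>

lemma cyclic_group_generator_nat:
  assumes fin: "finite (carrier G)"
  shows "cyclic_group G \<longleftrightarrow> (\<exists>x\<in>carrier G. carrier G \<subseteq> range (\<lambda>k::nat. x [^] k))"
proof -
  have "range (\<lambda>k::nat. x [^] k) = range (\<lambda>k::int. x [^] k)" "range (\<lambda>k::int. x [^] k) \<subseteq> carrier G"
    if "x \<in> carrier G" for x
  proof -
    have "ord x \<noteq> 0" using ord_ge_1[OF fin that] by simp
    with generate_pow_nat[OF that] generate_pow[OF that]
    show "range (\<lambda>k::nat. x [^] k) = range (\<lambda>k::int. x [^] k)" by (simp add: full_SetCompr_eq)
  qed (use that in auto)
  then show ?thesis unfolding cyclic_group by (metis subset_antisym subset_refl)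
qed

text \<open>The order of an element is the size of the subgroup that it generates.\<close>

lemma ord_generator:
  assumes "finite (carrier G)" "x \<in> carrier G" "carrier G \<subseteq> range (\<lambda>k::nat. x [^] k)"
  shows "ord x = order G"
proof -
  have "ord x \<noteq> 0" using ord_ge_1[OF assms(1,2)] by simp
  then have "generate G {x} = range (\<lambda>k::nat. x [^] k)"
    using generate_pow_nat[OF assms(2)] by auto
  also have "\<dots> = carrier G" using assms by auto
  finally show ?thesis using generate_pow_card[OF assms(2)] by (simp add: order_def)
qed

lemma powers_comparable_iff:
  assumes fin: "finite (carrier G)"
  shows "(\<forall>a\<in>carrier G. \<forall>b\<in>carrier G. \<exists>m::nat. a = b [^] m \<or> b = a [^] m) \<longleftrightarrow>
    cyclic_group G \<and> (order G = 1 \<or> (\<exists>(p::nat) (m::nat). prime p \<and> m > 0 \<and> order G = p ^ m))"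
    (is "?L \<longleftrightarrow> ?R")
proof
  assume L: ?L
  have pos: "ord a > 0" if "a \<in> carrier G" for a
    using ord_ge_1[OF fin that] by simp
  obtain x where x: "x \<in> carrier G" and max: "\<And>y. y \<in> carrier G \<Longrightarrow> ord y \<le> ord x"
  proof -
    have "Max (ord ` carrier G) \<in> ord ` carrier G"
      using fin by (intro Max_in) auto
    then obtain x where "x \<in> carrier G" "ord x = Max (ord ` carrier G)" by auto
    then show thesis using that[of x] fin by simp
  qed
  have gen: "carrier G \<subseteq> range (\<lambda>k::nat. x [^] k)"
  proof
    fix b assume b: "b \<in> carrier G"
    with L x obtain m :: nat where m: "x = b [^] m \<or> b = x [^] m" by blast
    show "b \<in> range (\<lambda>k::nat. x [^] k)"
    proof (cases "b = x [^] m")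
      case False
      \<comment> \<open>Maximality of \<open>ord x\<close> forces \<open>ord b = ord x\<close>, so
        \<open>m\<close> is invertible modulo \<open>ord b\<close>, and raising \<open>x\<close> to
        its inverse recovers \<open>b\<close>.\<close>
      then have xb: "x = b [^] m" using m by blast
      then have "ord x dvd ord b" using ord_pow_dvd[OF b] by blast
      then have "ord (b [^] m) = ord b"
        using max[OF b] pos[OF b] xb by (metis dvd_imp_le le_antisym)
      then have "coprime m (ord b)"
        using pow_ord_eq_ord_iff[OF fin b] by blast
      then obtain k where "[m * k = 1] (mod ord b)"
        using cong_solve_coprime_nat[of m "ord b"] by auto
      then have "b = x [^] k"
        using pow_cong_ord[OF b] b xb by (metis nat_pow_eone nat_pow_pow)
      then show ?thesis by blast
    qed auto
  qed
  have ordx: "ord x = order G" by (rule ord_generator[OF fin x gen])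
  have uniq: "p = q" if p: "prime p" "p dvd order G" and q: "prime q" "q dvd order G" for p q :: nat
  proof -
    \<comment> \<open>The generator raised to the cofactor of \<open>p\<close> has order
      \<open>p\<close>, so Cauchy's theorem is not invoked.\<close>
    have ex: "\<exists>a\<in>carrier G. ord a = p" if p: "p dvd order G" for p
    proof -
      obtain d where d: "order G = p * d" using p by blast
      moreover have "d \<noteq> 0" using d ordx pos[OF x] by auto
      ultimately have "ord (x [^] d) = p" using ord_pow[OF x, of d] ordx by simp
      then show ?thesis using x by blast
    qed
    obtain a b where ab: "a \<in> carrier G" "b \<in> carrier G" "ord a = p" "ord b = q"
      using ex[OF p(2)] ex[OF q(2)] by blast
    with L obtain m :: nat where "a = b [^] m \<or> b = a [^] m" by blast
    then have "p dvd q \<or> q dvd p" using ord_pow_dvd ab by metis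
    then show "p = q" using p q by (metis primes_dvd_imp_eq)
  qed
  have "order G > 0" using ordx pos[OF x] by simp
  then have "order G = 1 \<or> order G > 1" by linarith
  then have "order G = 1 \<or> (\<exists>(p::nat) (m::nat). prime p \<and> m > 0 \<and> order G = p ^ m)"
    using nat_primepowI[of "order G"] uniq by metis
  then show ?R using cyclic_group_generator_nat[OF fin] x gen by blast
next
  assume R: ?R
  \<comment> \<open>The trivial group is absorbed as \<open>2 ^ 0\<close>, hence \<open>k\<close>
    may be zero.\<close>
  obtain p k :: nat where pk: "prime p" "order G = p ^ k"
    using R two_is_prime_nat by (metis power_0)
  obtain x where x: "x \<in> carrier G" and gen: "carrier G \<subseteq> range (\<lambda>k::nat. x [^] k)"
    using R cyclic_group_generator_nat[OF fin] by blast
  have ordx: "ord x = p ^ k" using ord_generator[OF fin x gen] pk by simp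
  \<comment> \<open>By Bezout, \<open>x [^] i\<close> generates the same subgroup as
    \<open>x\<close> raised to \<open>gcd i (ord x)\<close>. Containment of such subgroups thus
    becomes divisibility of gcds.\<close>
  have pow: "\<exists>m::nat. x [^] j = (x [^] i) [^] m" if dvd: "gcd i (ord x) dvd gcd j (ord x)" for i j :: nat
  proof -
    obtain u where u: "[i * u = gcd i (ord x)] (mod ord x)" using cong_solve_nat by blast
    obtain v where "j = gcd i (ord x) * v" using dvd by (meson dvdE dvd_trans gcd_dvd1)
    then have "[j = i * (u * v)] (mod ord x)"
      using cong_scalar_right[OF cong_sym[OF u], of v] by (simp add: mult.assoc)
    then show ?thesis using pow_cong_ord[OF x] x by (metis nat_pow_pow)
  qed
  show ?L
  proof (intro ballI)
    fix a b assume "a \<in> carrier G" "b \<in> carrier G"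
    then obtain i j :: nat where ij: "a = x [^] i" "b = x [^] j" using gen by blast
    obtain s where s: "gcd i (ord x) = p ^ s"
      using divides_primepow_nat[OF pk(1)] ordx by (metis gcd_dvd2)
    obtain t where t: "gcd j (ord x) = p ^ t"
      using divides_primepow_nat[OF pk(1)] ordx by (metis gcd_dvd2)
    \<comment> \<open>Powers of one prime form a chain under divisibility.\<close>
    have "gcd i (ord x) dvd gcd j (ord x) \<or> gcd j (ord x) dvd gcd i (ord x)"
      unfolding s t by (meson le_imp_power_dvd linear)
    then show "\<exists>m::nat. a = b [^] m \<or> b = a [^] m" using pow ij by metis
  qed
qed

text \<open>The graph admits positive exponents only. Adding \<open>ord x\<close> to an exponent
  makes it positive without changing the power, so exponent 0 can be allowed in the group-theoretic
  part.\<close>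

lemma pow_eq_pos_pow:
  fixes m :: nat
  assumes "finite (carrier G)" "x \<in> carrier G"
  obtains n :: nat where "n > 0" "x [^] n = x [^] m"
proof
  show "m + ord x > 0" using ord_ge_1[OF assms] by simp
  show "x [^] (m + ord x) = x [^] m" using assms(2) by (intro pow_cong_ord) (auto simp: cong_def)
qed

end

section \<open>Cayley graphs: dominating vertices and complete graphs\<close>

lemma is_cayley_graph_dominating_imp_complete:
  assumes D: "pair_wf_digraph D" and cay: "is_cayley_graph D"
    and e: "e \<in> pverts D" and dom: "\<And>x. x \<in> pverts D \<Longrightarrow> x \<noteq> e \<Longrightarrow> (e, x) \<in> parcs D"
    and xy: "x \<in> pverts D" "y \<in> pverts D" "x \<noteq> y"
  shows "(x, y) \<in> parcs D"
proof -
  obtain K :: "'a monoid" and C where K: "group K" and C: "connection_set K C"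
    and iso: "digraph_iso (with_proj D) (with_proj (cayley_graph K C))"
    using cay unfolding is_cayley_graph_def by blast
  interpret K: group K by fact
  have wf: "pair_wf_digraph (cayley_graph K C)" by unfold_locales (auto simp: cayley_graph_def)
  obtain f where f: "bij_betw f (pverts D) (carrier K)"
    and adj: "\<And>x y. x \<in> pverts D \<Longrightarrow> y \<in> pverts D \<Longrightarrow>
      (x, y) \<in> parcs D \<longleftrightarrow> (f x, f y) \<in> parcs (cayley_graph K C)"
    using iso unfolding digraph_iso_with_proj_iff[OF D wf] by (auto simp: cayley_graph_def)
  have fcl: "f v \<in> carrier K" if "v \<in> pverts D" for v using f that by (rule bij_betwE[THEN bspec])
  have C_all: "c \<in> C" if c: "c \<in> carrier K" "c \<noteq> \<one>\<^bsub>K\<^esub>" for c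
  proof -
    \<comment> \<open>\<open>z\<close> is the vertex whose arc from \<open>e\<close> carries the
      label \<open>c\<close>. It differs from \<open>e\<close> because \<open>c\<close> is not the
      identity, so domination puts \<open>c\<close> into \<open>C\<close>.\<close>
    obtain z where z: "z \<in> pverts D" "f z = c \<otimes>\<^bsub>K\<^esub> f e"
      using f c fcl[OF e] by (metis K.m_closed bij_betw_iff_bijections)
    have "z \<noteq> e" using z c fcl[OF e] by (metis K.r_cancel_one)
    then have "f z \<otimes>\<^bsub>K\<^esub> inv\<^bsub>K\<^esub> f e \<in> C"
      using dom[OF z(1)] adj[OF e z(1)] by (simp add: cayley_graph_def)
    then show "c \<in> C" using z(2) c fcl[OF e] by (simp add: K.m_assoc)
  qed
  have "f x \<noteq> f y" using f xy by (meson bij_betw_def inj_onD)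
  then have "f y \<otimes>\<^bsub>K\<^esub> inv\<^bsub>K\<^esub> f x \<noteq> \<one>\<^bsub>K\<^esub>"
    using fcl xy by (metis K.inv_closed K.inv_equality K.inv_inv)
  then show ?thesis using adj xy C_all fcl by (simp add: cayley_graph_def)
qed

text \<open>Any group of the right size serves, with all non-identity elements as connection set.
  The integers modulo the number of vertices are such a group, and \<open>is_cayley_graphI\<close>
  transports it to the vertex type.\<close>

lemma is_cayley_graph_complete:
  assumes D: "pair_graph D" and ne: "pverts D \<noteq> {}"
    and complete: "\<And>x y. x \<in> pverts D \<Longrightarrow> y \<in> pverts D \<Longrightarrow> x \<noteq> y \<Longrightarrow> (x, y) \<in> parcs D"
  shows "is_cayley_graph D"
proof -
  interpret D: pair_graph D by fact
  define K where "K = integer_mod_group (card (pverts D))"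
  define C where "C = carrier K - {\<one>\<^bsub>K\<^esub>}"
  interpret K: group K by (simp add: K_def)
  have C: "connection_set K C"
    by (auto simp: connection_set_def C_def)
  have wf: "pair_wf_digraph (cayley_graph K C)" by unfold_locales (auto simp: cayley_graph_def)
  \<comment> \<open>Modulus 0 would give the infinite group of all integers.\<close>
  have "card (pverts D) > 0" using ne by (simp add: card_gt_0_iff)
  then have "finite (carrier K)" "card (carrier K) = card (pverts D)"
    by (auto simp: K_def carrier_integer_mod_group)
  then obtain f where f: "bij_betw f (pverts D) (carrier K)"
    using finite_same_card_bij[of "pverts D" "carrier K"] by auto
  have "(x, y) \<in> parcs D \<longleftrightarrow> (f x, f y) \<in> parcs (cayley_graph K C)"
    if xy: "x \<in> pverts D" "y \<in> pverts D" for x y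
  proof -
    have cl: "f x \<in> carrier K" "f y \<in> carrier K" using f xy by (auto dest: bij_betwE)
    have "(x, y) \<in> parcs D \<longleftrightarrow> x \<noteq> y" using complete[OF xy] D.no_loops[of "(x, y)"] by auto
    also have "\<dots> \<longleftrightarrow> f x \<noteq> f y" using f xy by (meson bij_betw_def inj_onD)
    also have "\<dots> \<longleftrightarrow> f y \<otimes>\<^bsub>K\<^esub> inv\<^bsub>K\<^esub> f x \<noteq> \<one>\<^bsub>K\<^esub>"
      using cl by (metis K.inv_closed K.inv_equality K.inv_inv K.r_inv)
    finally show ?thesis using cl by (auto simp: cayley_graph_def C_def)
  qed
  then have "digraph_iso (with_proj D) (with_proj (cayley_graph K C))"
    unfolding digraph_iso_with_proj_iff[OF D.pair_wf_digraph_axioms wf]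
    using f by (auto simp: cayley_graph_def)
  then show ?thesis by (rule is_cayley_graphI[OF D.pair_wf_digraph_axioms K.is_group C])
qed

section \<open>From the power graph to the quotient group\<close>

lemma nsb_power_graph_arc_iff:
  fixes G (structure)
  assumes "finite (carrier G)" "H \<lhd> G"
    and xy: "x \<in> pverts (nsb_power_graph G H)" "y \<in> pverts (nsb_power_graph G H)"
  shows "(x, y) \<in> parcs (nsb_power_graph G H) \<longleftrightarrow> x \<noteq> y \<and>
    (\<exists>m::nat. H #>\<^bsub>G\<^esub> x = (H #>\<^bsub>G\<^esub> y) [^]\<^bsub>G Mod H\<^esub> m \<or> H #>\<^bsub>G\<^esub> y = (H #>\<^bsub>G\<^esub> x) [^]\<^bsub>G Mod H\<^esub> m)"
proof -
  interpret normal H G by fact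
  interpret Q: group "G Mod H" by (rule factorgroup_is_group)
  have finQ: "finite (carrier (G Mod H))" using assms(1) by (simp add: carrier_FactGroup)
  have cl: "x \<in> carrier G" "y \<in> carrier G"
    using xy by (auto simp: nsb_power_graph_def Let_def)
  \<comment> \<open>Two changes at once: normality turns the left cosets of the graph into the right
    cosets that form the quotient, and finiteness of the quotient removes the positivity of the
    exponent.\<close>
  have pos: "(\<exists>m::nat. m > 0 \<and> u <# H = (v [^] m) <# H) \<longleftrightarrow>
      (\<exists>m::nat. H #> u = (H #> v) [^]\<^bsub>G Mod H\<^esub> m)"
    if uv: "u \<in> carrier G" "v \<in> carrier G" for u v
  proof -
    have "u <# H = (v [^] m) <# H \<longleftrightarrow> H #> u = (H #> v) [^]\<^bsub>G Mod H\<^esub> m" for m :: nat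
      using uv by (simp add: FactGroup_pow coset_eq[THEN bspec, symmetric])
    moreover have "H #> v \<in> carrier (G Mod H)" using uv by (auto simp: carrier_FactGroup)
    ultimately show ?thesis by (metis Q.pow_eq_pos_pow[OF finQ])
  qed
  have "(x, y) \<in> parcs (nsb_power_graph G H) \<longleftrightarrow> x \<noteq> y \<and>
    ((\<exists>m::nat. m > 0 \<and> x <# H = (y [^] m) <# H) \<or> (\<exists>n::nat. n > 0 \<and> y <# H = (x [^] n) <# H))"
    using xy by (simp add: nsb_power_graph_def Let_def)
  then show ?thesis unfolding pos[OF cl] pos[OF cl(2,1)] by blast
qed

lemma nsb_power_graph_complete_iff:
  fixes G (structure)
  assumes "finite (carrier G)" "H \<lhd> G"
  defines "D \<equiv> nsb_power_graph G H"
  shows "(\<forall>x\<in>pverts D. \<forall>y\<in>pverts D. x \<noteq> y \<longrightarrow> (x, y) \<in> parcs D) \<longleftrightarrow>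
    (\<forall>a\<in>carrier (G Mod H). \<forall>b\<in>carrier (G Mod H).
      \<exists>m::nat. a = b [^]\<^bsub>G Mod H\<^esub> m \<or> b = a [^]\<^bsub>G Mod H\<^esub> m)" (is "?L \<longleftrightarrow> ?R")
proof
  interpret normal H G by fact
  interpret Q: group "G Mod H" by (rule factorgroup_is_group)
  note arc = nsb_power_graph_arc_iff[OF assms(1,2), folded D_def]
  have V: "pverts D = (carrier G - H) \<union> {\<one>}" by (simp add: D_def nsb_power_graph_def Let_def)
  \<comment> \<open>Deleting the non-identity elements of \<open>H\<close> loses no coset, since the
    coset \<open>H\<close> keeps the identity as representative.\<close>
  have rep: "\<exists>x\<in>pverts D. a = H #> x" if a: "a \<in> carrier (G Mod H)" for a
  proof -
    obtain x where x: "x \<in> carrier G" "a = H #> x" using a by (auto simp: carrier_FactGroup)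
    show ?thesis
    proof (cases "x \<in> H")
      case True
      then have "a = H #> \<one>" using x rcos_const[of x] rcos_const[of \<one>] is_subgroup by simp
      then show ?thesis using V by blast
    qed (use x V in blast)
  qed
  {
    assume L: ?L
    show ?R
    proof (intro ballI)
      fix a b assume "a \<in> carrier (G Mod H)" and b: "b \<in> carrier (G Mod H)"
      then obtain x y where xy: "x \<in> pverts D" "a = H #> x" "y \<in> pverts D" "b = H #> y"
        using rep by blast
      show "\<exists>m::nat. a = b [^]\<^bsub>G Mod H\<^esub> m \<or> b = a [^]\<^bsub>G Mod H\<^esub> m"
      proof (cases "x = y")
        \<comment> \<open>The graph has no loops, so this case is settled by exponent 1 instead of
          an arc.\<close>
        case True
        then have "a = b [^]\<^bsub>G Mod H\<^esub> (1::nat)" using xy b Q.nat_pow_eone by metis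
        then show ?thesis by blast
      next
        case False
        then show ?thesis using L arc xy by blast
      qed
    qed
  next
    assume R: ?R
    have "H #> v \<in> carrier (G Mod H)" if "v \<in> pverts D" for v
      using that V by (auto simp: carrier_FactGroup)
    then show ?L using R arc by blast
  }
qed

theorem theorem3p3:
  fixes G :: "('a, 'b) monoid_scheme" and H :: "'a set"
  assumes "group G" and "finite (carrier G)" and "H \<lhd> G"
  shows "is_cayley_graph (nsb_power_graph G H) \<longleftrightarrow>
    cyclic_group (G Mod H) \<and>
    (order (G Mod H) = 1 \<or>
     (\<exists>(p::nat) (m::nat). prime p \<and> m > 0 \<and> order (G Mod H) = p ^ m))"
proof -
  interpret normal H G by fact
  interpret Q: group "G Mod H" by (rule factorgroup_is_group)
  have finQ: "finite (carrier (G Mod H))" using assms(2) by (simp add: carrier_FactGroup)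
  define D where "D = nsb_power_graph G H"
  interpret D: pair_graph D unfolding D_def by (rule pair_graph_nsb_power_graph[OF assms(2,3)])
  have V: "pverts D = (carrier G - H) \<union> {\<one>\<^bsub>G\<^esub>}" by (simp add: D_def nsb_power_graph_def Let_def)
  have "(\<one>\<^bsub>G\<^esub>, x) \<in> parcs D" if x: "x \<in> pverts D" "x \<noteq> \<one>\<^bsub>G\<^esub>" for x
  proof -
    \<comment> \<open>Exponent 0 is legitimate here because \<open>nsb_power_graph_arc_iff\<close>
      has dropped positivity.\<close>
    have "H #>\<^bsub>G\<^esub> \<one>\<^bsub>G\<^esub> = (H #>\<^bsub>G\<^esub> x) [^]\<^bsub>G Mod H\<^esub> (0::nat)" by (simp add: coset_mult_one subset)
    then show ?thesis
      using nsb_power_graph_arc_iff[OF assms(2,3), folded D_def, of "\<one>\<^bsub>G\<^esub>" x] x V by blast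
  qed
  then have "is_cayley_graph D \<longleftrightarrow> (\<forall>x\<in>pverts D. \<forall>y\<in>pverts D. x \<noteq> y \<longrightarrow> (x, y) \<in> parcs D)"
    using is_cayley_graph_dominating_imp_complete[OF D.pair_wf_digraph_axioms, of "\<one>\<^bsub>G\<^esub>"]
      is_cayley_graph_complete[OF D.pair_graph_axioms] V
    by blast
  then show ?thesis
    using nsb_power_graph_complete_iff[OF assms(2,3)] Q.powers_comparable_iff[OF finQ]
    by (simp add: D_def)
qed

end
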